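(* Consider an instance with cardinality-based rates $(N,d,(r_1,\dots,r_N))$ and let $m^*\in\operatorname{argmax}_{m=1,\dots,N} m\,r_m$. If all demand values are equal to a common value $d>0$, then the schedule that activates the $N$ groups $\{1,2,\dots,m^*\}$, $\{2,3,\dots,m^*+1\}$, $\dots$, $\{N,1,\dots,m^*-1\}$ (cyclically consecutive links, indices taken modulo $N$), each for a time duration of $\frac{d}{m^*r_{m^*}}$, is optimal.
   Context: $\mathcal N=\{1,\dots,N\}$ is a set of links, each with a strictly positive demand $d_i$. $\mathcal H$ is the set of all nonempty subsets of $\mathcal N$, called groups. Cardinality-based rates: there are numbers $r_1\ge r_2\ge\dots\ge r_N\ge 0$ with $r_1>0$ such that, when group $\mathcal c$ is active, every link $i\in \mathcal c$ is served at rate $r_{|\mathcal c|}$ and links outside $\mathcal c$ at rate $0$. A schedule is a vector $T=(T_{\mathcal c})_{\mathcal c\in\mathcal H}\ge 0$ with $\sum_{\mathcal c\ni i}r_{|\mathcal c|}T_{\mathcal c}=d_i$ for every $i$; its length is $\sum_{\mathcal c}T_{\mathcal c}$; it is optimal if its length is minimum. If the same group occurs several times in a list of activations, its durations are added. *)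

theory Defs
  imports Complex_Main
begin

definition groups :: "nat \<Rightarrow> nat set set" where
  "groups N = {c. c \<subseteq> {1..N} \<and> c \<noteq> {}}"

text \<open>Only the rates \<open>r 1, \<dots>, r N\<close> and the demands \<open>d 1, \<dots>, d N\<close> are meaningful.\<close>

definition cardinality_instance :: "nat \<Rightarrow> (nat \<Rightarrow> real) \<Rightarrow> (nat \<Rightarrow> real) \<Rightarrow> bool" where
  "cardinality_instance N d r \<longleftrightarrow>
     1 \<le> N \<and> (\<forall>i\<in>{1..N}. 0 < d i) \<and>
     (\<forall>i\<in>{1..N}. \<forall>j\<in>{1..N}. i \<le> j \<longrightarrow> r j \<le> r i) \<and> 0 \<le> r N \<and> 0 < r 1"

text \<open>A vector indexed by the groups is a function on sets of links whose values
  outside \<open>groups N\<close> are ignored.\<close>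

definition is_schedule ::
  "nat \<Rightarrow> (nat \<Rightarrow> real) \<Rightarrow> (nat \<Rightarrow> real) \<Rightarrow> (nat set \<Rightarrow> real) \<Rightarrow> bool" where
  "is_schedule N d r T \<longleftrightarrow>
     (\<forall>c\<in>groups N. 0 \<le> T c) \<and>
     (\<forall>i\<in>{1..N}. (\<Sum>c\<in>{c\<in>groups N. i \<in> c}. r (card c) * T c) = d i)"

definition schedule_length :: "nat \<Rightarrow> (nat set \<Rightarrow> real) \<Rightarrow> real" where
  "schedule_length N T = (\<Sum>c\<in>groups N. T c)"

definition optimal_schedule ::
  "nat \<Rightarrow> (nat \<Rightarrow> real) \<Rightarrow> (nat \<Rightarrow> real) \<Rightarrow> (nat set \<Rightarrow> real) \<Rightarrow> bool" where
  "optimal_schedule N d r T \<longleftrightarrow> is_arg_min (schedule_length N) (is_schedule N d r) T"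

text \<open>A list of activations (group, duration) determines a vector: durations of repeated
  occurrences of the same group are added.\<close>

definition schedule_of :: "(nat set \<times> real) list \<Rightarrow> nat set \<Rightarrow> real" where
  "schedule_of acts c = (\<Sum>(g, t)\<leftarrow>acts. if g = c then t else 0)"

text \<open>The \<open>m\<close> cyclically consecutive links starting with link \<open>k\<close>; the shift by one
  keeps the representatives modulo \<open>N\<close> in \<open>{1..N}\<close>.\<close>

definition cyclic_group :: "nat \<Rightarrow> nat \<Rightarrow> nat \<Rightarrow> nat set" where
  "cyclic_group N m k = {(k - 1 + j) mod N + 1 | j. j < m}"

definition cyclic_activations :: "nat \<Rightarrow> nat \<Rightarrow> real \<Rightarrow> (nat set \<times> real) list" where
  "cyclic_activations N m t = [(cyclic_group N m k, t). k \<leftarrow> [1..<N+1]]"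

end

theory Submission
  imports Defs "HOL-Number_Theory.Cong"
begin

text \<open>Summing the demand equations of any schedule \<open>T\<close> over all links counts the group
  \<open>c\<close> with weight \<open>|c| r\<^bsub>|c|\<^esub> \<le> m r\<^sub>m\<close>, so the length of \<open>T\<close> is at least
  \<open>N d / (m r\<^sub>m)\<close>. The cyclic schedule attains this bound, and it serves all links equally
  because each link lies in exactly \<open>m\<close> of the \<open>N\<close> cyclic windows.\<close>

lemma finite_groups: "finite (groups N)"
  by (rule finite_subset[of _ "Pow {1..N}"]) (auto simp: groups_def)

text \<open>Exchanging the sum over \<open>C\<close> with the sum over the list replaces weights of
  groups by weights of activations. No distinctness of the activated groups is required.\<close>

lemma sum_schedule_of:
  assumes "finite C"
  shows "(\<Sum>c\<in>C. f c * schedule_of acts c) = (\<Sum>(g, t)\<leftarrow>acts. if g \<in> C then f g * t else 0)"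
proof (induction acts)
  case Nil
  show ?case by (simp add: schedule_of_def)
next
  case (Cons a acts)
  obtain g t where a: "a = (g, t)" by (cases a)
  have "(\<Sum>c\<in>C. f c * schedule_of (a # acts) c)
      = (\<Sum>c\<in>C. if g = c then f c * t else 0) + (\<Sum>c\<in>C. f c * schedule_of acts c)"
    unfolding sum.distrib[symmetric]
    by (rule sum.cong) (auto simp: schedule_of_def a algebra_simps)
  also have "(\<Sum>c\<in>C. if g = c then f c * t else 0) = (if g \<in> C then f g * t else 0)"
    using assms by (simp add: sum.delta')
  finally show ?case using Cons.IH by (simp add: a)
qed

text \<open>Indexing by the starting link \<open>k\<close> instead of by the group counts coinciding
  windows with their multiplicity. This matters for \<open>m = N\<close>, where all \<open>N\<close>
  windows are the same set.\<close>

lemma sum_schedule_of_cyclic_activations: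
  assumes "finite C"
  shows "(\<Sum>c\<in>C. f c * schedule_of (cyclic_activations N m t) c)
    = (\<Sum>k\<in>{k\<in>{1..N}. cyclic_group N m k \<in> C}. f (cyclic_group N m k) * t)"
proof -
  have "(\<Sum>c\<in>C. f c * schedule_of (cyclic_activations N m t) c)
      = (\<Sum>k\<leftarrow>[1..<N+1]. if cyclic_group N m k \<in> C then f (cyclic_group N m k) * t else 0)"
    unfolding sum_schedule_of[OF assms] cyclic_activations_def by (simp add: comp_def)
  also have "\<dots> = (\<Sum>k\<in>{1..N}. if cyclic_group N m k \<in> C then f (cyclic_group N m k) * t else 0)"
    by (subst interv_sum_list_conv_sum_set_nat)
      (simp add: atLeastLessThanSuc_atLeastAtMost del: upt_Suc)
  also have "\<dots> = (\<Sum>k\<in>{k\<in>{1..N}. cyclic_group N m k \<in> C}. f (cyclic_group N m k) * t)"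
    by (simp add: sum.If_cases Int_def conj_commute)
  finally show ?thesis .
qed

text \<open>Offsets below \<open>N\<close> are distinct residues. This gives both the size of a
  window and the number of windows through a link.\<close>

lemma inj_on_add_mod:
  fixes a m N :: nat
  assumes "m \<le> N"
  shows "inj_on (\<lambda>j. (a + j) mod N) {..<m}"
proof (rule inj_onI)
  fix x y assume "x \<in> {..<m}" "y \<in> {..<m}" "(a + x) mod N = (a + y) mod N"
  then have "[x = y] (mod N)" "x < N" "y < N"
    using assms by (auto simp flip: cong_def simp: cong_add_lcancel_nat)
  then show "x = y" by (simp add: cong_less_modulus_unique_nat)
qed

lemma cyclic_group_eq_image: "cyclic_group N m k = (\<lambda>j. (k - 1 + j) mod N + 1) ` {..<m}"
  by (auto simp: cyclic_group_def)

lemma card_cyclic_group: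
  assumes "m \<le> N"
  shows "card (cyclic_group N m k) = m"
proof -
  have "inj_on (\<lambda>j. (k - 1 + j) mod N + 1) {..<m}"
    using inj_on_add_mod[OF assms, of "k - 1"] by (simp add: inj_on_def)
  then show ?thesis by (simp add: cyclic_group_eq_image card_image)
qed

lemma cyclic_group_in_groups:
  assumes "1 \<le> m" "1 \<le> N"
  shows "cyclic_group N m k \<in> groups N"
  using assms by (auto simp: groups_def cyclic_group_eq_image Suc_le_eq lessThan_empty_iff)

text \<open>Going around the cycle, the windows of length \<open>m\<close> that contain
  \<open>i\<close> are those starting at \<open>i - m + 1\<close>, ..., \<open>i\<close>; these
  \<open>m\<close> starts are distinct modulo \<open>N\<close>.\<close>

lemma card_cyclic_groups_containing:
  assumes "m \<le> N" "i \<in> {1..N}"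
  shows "card {k\<in>{1..N}. i \<in> cyclic_group N m k} = m"
proof -
  \<comment> \<open>The start \<open>i - m + 1 + j\<close>, reduced modulo \<open>N\<close> to a
    representative in \<open>{1..N}\<close>. Adding \<open>N - m\<close> in place of subtracting
    \<open>m\<close> avoids truncated subtraction.\<close>
  let ?f = "\<lambda>j. (i + (N - m) + j) mod N + 1"
  have "{k\<in>{1..N}. i \<in> cyclic_group N m k} = ?f ` {..<m}"
  proof (intro set_eqI iffI)
    fix k assume k: "k \<in> {k\<in>{1..N}. i \<in> cyclic_group N m k}"
    then obtain j where j: "j < m" "i = (k - 1 + j) mod N + 1"
      by (auto simp: cyclic_group_def)
    \<comment> \<open>If \<open>i\<close> has offset \<open>j\<close> in the window starting at
      \<open>k\<close>, then \<open>k\<close> has the complementary index \<open>m - 1 - j\<close>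
      in the list of starts: both sides are \<open>i - 1 + N - j\<close>.\<close>
    have "(i + (N - m) + (m - 1 - j)) mod N = ((k - 1 + j) mod N + (N - j)) mod N"
      using j assms by (intro arg_cong[where f = "\<lambda>x. x mod N"]) linarith
    also have "\<dots> = (k - 1 + N) mod N"
      unfolding mod_add_left_eq using j assms by simp
    also have "\<dots> = k - 1" unfolding mod_add_self2 using k by auto
    finally have "k = ?f (m - 1 - j)" using k by simp
    then show "k \<in> ?f ` {..<m}" by (rule image_eqI) (use j(1) in simp)
  next
    fix k assume "k \<in> ?f ` {..<m}"
    then obtain l where l: "l < m" "k = ?f l" by auto
    \<comment> \<open>Conversely, in the window with the start of index \<open>l\<close>, link
      \<open>i\<close> has offset \<open>m - 1 - l\<close>.\<close>
    have "(k - 1 + (m - 1 - l)) mod N = (i + (N - m) + l + (m - 1 - l)) mod N"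
      unfolding l(2) add_diff_cancel_right' by (rule mod_add_left_eq)
    also have "\<dots> = (i - 1 + N) mod N"
      using l assms by (intro arg_cong[where f = "\<lambda>x. x mod N"]) auto
    also have "\<dots> = i - 1" unfolding mod_add_self2 using assms by auto
    finally have "i = (k - 1 + (m - 1 - l)) mod N + 1" using assms by simp
    then have "i \<in> cyclic_group N m k"
      unfolding cyclic_group_eq_image by (rule image_eqI) (use l(1) in simp)
    moreover have "k \<in> {1..N}" using l assms by (auto simp: Suc_le_eq)
    ultimately show "k \<in> {k\<in>{1..N}. i \<in> cyclic_group N m k}" by simp
  qed
  moreover have "inj_on ?f {..<m}"
    using inj_on_add_mod[OF assms(1), of "i + (N - m)"] by (simp add: inj_on_def)
  ultimately show ?thesis by (simp add: card_image)
qed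

lemma is_schedule_cyclic_activations:
  assumes "1 \<le> m" "m \<le> N" "0 < r m" "0 < d" "\<forall>i\<in>{1..N}. \<delta> i = d"
  shows "is_schedule N \<delta> r (schedule_of (cyclic_activations N m (d / (real m * r m))))"
proof -
  let ?t = "d / (real m * r m)"
  let ?T = "schedule_of (cyclic_activations N m ?t)"
  have "0 \<le> ?T c" for c
    using assms unfolding schedule_of_def cyclic_activations_def
    by (intro sum_list_nonneg) auto
  moreover have "(\<Sum>c\<in>{c\<in>groups N. i \<in> c}. r (card c) * ?T c) = \<delta> i" if i: "i \<in> {1..N}" for i
  proof -
    \<comment> \<open>Every window has cardinality \<open>m\<close>, so each one containing
      \<open>i\<close> contributes the same amount \<open>r m * ?t\<close>; only their number
      remains to be found.\<close>
    have "(\<Sum>c\<in>{c\<in>groups N. i \<in> c}. r (card c) * ?T c)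
        = real (card {k\<in>{1..N}. i \<in> cyclic_group N m k}) * (r m * ?t)"
      using assms cyclic_group_in_groups[of m N]
      by (subst sum_schedule_of_cyclic_activations) (simp_all add: finite_groups card_cyclic_group)
    also have "\<dots> = d"
      unfolding card_cyclic_groups_containing[OF assms(2) i] using assms by simp
    finally show ?thesis using assms i by simp
  qed
  ultimately show ?thesis by (simp add: is_schedule_def)
qed

lemma schedule_length_cyclic_activations:
  assumes "1 \<le> m" "1 \<le> N"
  shows "schedule_length N (schedule_of (cyclic_activations N m t)) = real N * t"
proof -
  have "{k\<in>{1..N}. cyclic_group N m k \<in> groups N} = {1..N}"
    using cyclic_group_in_groups[OF assms] by blast
  then show ?thesis
    using sum_schedule_of_cyclic_activations[OF finite_groups[of N], of "\<lambda>_. 1" N m t]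
    by (simp add: schedule_length_def)
qed

lemma sum_demands_eq:
  assumes "is_schedule N \<delta> r T"
  shows "(\<Sum>i\<in>{1..N}. \<delta> i) = (\<Sum>c\<in>groups N. real (card c) * r (card c) * T c)"
proof -
  have "(\<Sum>i\<in>{1..N}. \<delta> i) = (\<Sum>i\<in>{1..N}. \<Sum>c\<in>{c\<in>groups N. i \<in> c}. r (card c) * T c)"
    using assms by (simp add: is_schedule_def)
  \<comment> \<open>Double counting of the pairs of a link and a group containing it.\<close>
  also have "\<dots> = (\<Sum>c\<in>groups N. \<Sum>i\<in>{i\<in>{1..N}. i \<in> c}. r (card c) * T c)"
    by (rule sum.swap_restrict) (auto simp: finite_groups)
  also have "\<dots> = (\<Sum>c\<in>groups N. real (card c) * r (card c) * T c)"
  proof (rule sum.cong[OF refl])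
    fix c assume "c \<in> groups N"
    then have "{i\<in>{1..N}. i \<in> c} = c" by (auto simp: groups_def)
    then show "(\<Sum>i\<in>{i\<in>{1..N}. i \<in> c}. r (card c) * T c) = real (card c) * r (card c) * T c"
      by simp
  qed
  finally show ?thesis .
qed

lemma sum_demands_le_schedule_length:
  assumes "is_schedule N \<delta> r T" "\<And>k. k \<in> {1..N} \<Longrightarrow> real k * r k \<le> M"
  shows "(\<Sum>i\<in>{1..N}. \<delta> i) \<le> M * schedule_length N T"
proof -
  have "real (card c) * r (card c) * T c \<le> M * T c" if c: "c \<in> groups N" for c
  proof -
    have sub: "c \<subseteq> {1..N}" "c \<noteq> {}" using c by (auto simp: groups_def)
    then have "finite c" using finite_subset by blast
    \<comment> \<open>The bound \<open>M\<close> is assumed only for cardinalities in this range; it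
      can then be multiplied by \<open>T c\<close>, which is nonnegative.\<close>
    with sub have "card c \<in> {1..N}"
      using card_mono[OF _ sub(1)] by (simp add: Suc_le_eq card_gt_0_iff)
    then show ?thesis
      using assms c by (intro mult_right_mono) (auto simp: is_schedule_def)
  qed
  then show ?thesis
    unfolding sum_demands_eq[OF assms(1)] schedule_length_def sum_distrib_left
    by (rule sum_mono)
qed

theorem theorem14:
  fixes N m :: nat and \<delta> r :: "nat \<Rightarrow> real" and d :: real
  assumes "cardinality_instance N \<delta> r"
    and "is_arg_max (\<lambda>k. real k * r k) (\<lambda>k. k \<in> {1..N}) m"
    and "0 < d"
    and "\<forall>i\<in>{1..N}. \<delta> i = d"
  shows "optimal_schedule N \<delta> r (schedule_of (cyclic_activations N m (d / (real m * r m))))"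
proof -
  have N: "1 \<le> N" and r1: "0 < r 1" using assms(1) by (auto simp: cardinality_instance_def)
  have m: "1 \<le> m" "m \<le> N" and max: "\<And>k. k \<in> {1..N} \<Longrightarrow> real k * r k \<le> real m * r m"
    using assms(2) by (auto simp: is_arg_max_linorder)
  \<comment> \<open>Comparing the maximizer with \<open>k = 1\<close> gives
    \<open>r 1 \<le> real m * r m\<close>, so the duration has a positive denominator.\<close>
  have pos: "0 < real m * r m" using max[of 1] N r1 by simp
  then have rm: "0 < r m" by (simp add: zero_less_mult_iff)
  let ?T = "schedule_of (cyclic_activations N m (d / (real m * r m)))"
  have "schedule_length N ?T \<le> schedule_length N S" if S: "is_schedule N \<delta> r S" for S
  proof -
    have "real N * d \<le> real m * r m * schedule_length N S"
      using sum_demands_le_schedule_length[OF S max] assms(4) by simp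
    then show ?thesis
      unfolding schedule_length_cyclic_activations[OF m(1) N]
      using pos by (simp add: divide_le_eq mult.commute)
  qed
  with is_schedule_cyclic_activations[of m N r, OF m rm assms(3,4)]
  show ?thesis by (auto simp: optimal_schedule_def is_arg_min_linorder)
qed

end
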